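(* Let $G$ be a group with identity $e$, $R$ a $G$-graded commutative ring with identity, $M$ a $G$-graded $R$-module, $I=\oplus_{g\in G}I_g$ a graded ideal of $R$, and $N$ a proper graded submodule of $M$. Let $K=\oplus_{h\in G}K_h$ be a graded submodule of $M$. Then the following statements are equivalent: (i) $N$ is a graded $I_e$-prime submodule of $M$. (ii) For any $r_g\in h(R)$ and $h\in G$ with $r_gK_h\subseteq N$ and $r_gK_h\not\subseteq I_eN$, either $K_h\subseteq N$ or $r_g\in (N:_RM)$.
   Context: Modules are unitary. For a $G$-graded ring $R=\oplus_{g\in G}R_g$ and graded module $M=\oplus_{g\in G}M_g$ ($R_gM_h\subseteq M_{gh}$), $h(R)=\cup_gR_g$ and $h(M)=\cup_gM_g$ are the sets of homogeneous elements. A graded ideal is $I=\oplus_g I_g$ with $I_g=I\cap R_g$; a graded submodule is $K=\oplus_gK_g$ with $K_g=K\cap M_g$. $(N:_RM)=\{r\in R: rM\subseteq N\}$. $I_eN$ is the set of finite sums of products $an$ with $a\in I_e$, $n\in N$. A graded submodule $N$ of $M$ is a graded $I_e$-prime submodule if $N\neq M$ and whenever $r\in h(R)$, $m\in h(M)$ satisfy $rm\in N$ and $rm\notin I_eN$, then $m\in N$ or $r\in(N:_RM)$.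
   Formalization: The graded submodule K is quantified inside (ii) (for every graded submodule K) rather than fixed beforehand; for a fixed K, e.g. K = 0 with trivial G, R = M = Z, I = 0, N = 4Z, (ii) holds but (i) fails. *)

theory Defs
  imports "HOL-Algebra.Ideal" "HOL-Algebra.Module" "HOL-Library.FuncSet"
begin

(* H is the internal direct sum of the additive subgroups D j (j in J) of A. Members of PiE are
   "undefined" outside J, so "exists exactly one f" is uniqueness of the family (f j), j in J. *)
definition internal_direct_sum ::
    "('a, 'm) ring_scheme \<Rightarrow> 'a set \<Rightarrow> 'j set \<Rightarrow> ('j \<Rightarrow> 'a set) \<Rightarrow> bool" where
  "internal_direct_sum A H J D \<longleftrightarrow>
     additive_subgroup H A \<and>
     (\<forall>j\<in>J. additive_subgroup (D j) A \<and> D j \<subseteq> H) \<and>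
     (\<forall>x\<in>H. \<exists>!f. f \<in> (\<Pi>\<^sub>E j\<in>J. D j) \<and> finite {j \<in> J. f j \<noteq> \<zero>\<^bsub>A\<^esub>} \<and>
        x = (\<Oplus>\<^bsub>A\<^esub>j\<in>{j \<in> J. f j \<noteq> \<zero>\<^bsub>A\<^esub>}. f j))"

locale graded_cring = group G + cring R
  for G :: "('g, 'p) monoid_scheme" (structure)
    and R :: "('a, 'q) ring_scheme" (structure)
    and Rg :: "'g \<Rightarrow> 'a set" +
  assumes ring_direct_sum: "internal_direct_sum R (carrier R) (carrier G) Rg"
    and ring_graded_mult: "\<lbrakk>g \<in> carrier G; h \<in> carrier G; a \<in> Rg g; b \<in> Rg h\<rbrakk>
      \<Longrightarrow> a \<otimes>\<^bsub>R\<^esub> b \<in> Rg (g \<otimes>\<^bsub>G\<^esub> h)"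

locale graded_module = graded_cring G R Rg + module R M
  for G :: "('g, 'p) monoid_scheme" (structure)
    and R :: "('a, 'q) ring_scheme" (structure)
    and Rg :: "'g \<Rightarrow> 'a set"
    and M :: "('a, 'b, 'r) module_scheme" (structure)
    and Mg :: "'g \<Rightarrow> 'b set" +
  assumes module_direct_sum: "internal_direct_sum M (carrier M) (carrier G) Mg"
    and module_graded_smult: "\<lbrakk>g \<in> carrier G; h \<in> carrier G; a \<in> Rg g; x \<in> Mg h\<rbrakk>
      \<Longrightarrow> a \<odot>\<^bsub>M\<^esub> x \<in> Mg (g \<otimes>\<^bsub>G\<^esub> h)"

definition homogeneous :: "('g, 'p) monoid_scheme \<Rightarrow> ('g \<Rightarrow> 'c set) \<Rightarrow> 'c set" where
  "homogeneous G D = (\<Union>g\<in>carrier G. D g)"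

definition graded_ideal ::
    "('g, 'p) monoid_scheme \<Rightarrow> ('a, 'q) ring_scheme \<Rightarrow> ('g \<Rightarrow> 'a set) \<Rightarrow> 'a set \<Rightarrow> bool" where
  "graded_ideal G R Rg I \<longleftrightarrow>
     ideal I R \<and> internal_direct_sum R I (carrier G) (\<lambda>g. I \<inter> Rg g)"

definition graded_submodule ::
    "('g, 'p) monoid_scheme \<Rightarrow> ('a, 'q) ring_scheme \<Rightarrow> ('a, 'b, 'r) module_scheme \<Rightarrow>
     ('g \<Rightarrow> 'b set) \<Rightarrow> 'b set \<Rightarrow> bool" where
  "graded_submodule G R M Mg K \<longleftrightarrow>
     submodule K R M \<and> internal_direct_sum M K (carrier G) (\<lambda>g. K \<inter> Mg g)"

definition module_colon ::
    "('a, 'q) ring_scheme \<Rightarrow> ('a, 'b, 'r) module_scheme \<Rightarrow> 'b set \<Rightarrow> 'a set" where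
  "module_colon R M N = {r \<in> carrier R. \<forall>x\<in>carrier M. r \<odot>\<^bsub>M\<^esub> x \<in> N}"

definition set_smult :: "('a, 'b, 'r) module_scheme \<Rightarrow> 'a set \<Rightarrow> 'b set \<Rightarrow> 'b set" where
  "set_smult M S N =
     {\<Oplus>\<^bsub>M\<^esub>i\<in>{..<k}. a i \<odot>\<^bsub>M\<^esub> n i | (k::nat) a n. a \<in> {..<k} \<rightarrow> S \<and> n \<in> {..<k} \<rightarrow> N}"

definition graded_Ie_prime ::
    "('g, 'p) monoid_scheme \<Rightarrow> ('a, 'q) ring_scheme \<Rightarrow> ('g \<Rightarrow> 'a set) \<Rightarrow>
     ('a, 'b, 'r) module_scheme \<Rightarrow> ('g \<Rightarrow> 'b set) \<Rightarrow> 'a set \<Rightarrow> 'b set \<Rightarrow> bool" where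
  "graded_Ie_prime G R Rg M Mg I N \<longleftrightarrow>
     graded_submodule G R M Mg N \<and> N \<noteq> carrier M \<and>
     (\<forall>r\<in>homogeneous G Rg. \<forall>x\<in>homogeneous G Mg.
        r \<odot>\<^bsub>M\<^esub> x \<in> N \<and> r \<odot>\<^bsub>M\<^esub> x \<notin> set_smult M (I \<inter> Rg \<one>\<^bsub>G\<^esub>) N \<longrightarrow>
        x \<in> N \<or> r \<in> module_colon R M N)"

end

theory Submission
  imports Defs
begin

text \<open>
  For (i) \<open>\<Longrightarrow>\<close> (ii), pick \<open>x \<in> K\<^sub>h\<close> with \<open>r x \<notin> I\<^sub>e N\<close>; then \<open>x \<in> N\<close>. If some
  \<open>y \<in> K\<^sub>h\<close> were not in \<open>N\<close>, neither \<open>x + y\<close> nor \<open>- y\<close> would be, so primeness would put both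
  \<open>r (x + y)\<close> and \<open>r (- y)\<close>, hence their sum \<open>r x\<close>, into \<open>I\<^sub>e N\<close>. For the converse, apply (ii)
  to the cyclic submodule \<open>R x\<close>, which is graded because \<open>x\<close> is homogeneous.
\<close>

text \<open>A family with members in \<open>K \<inter> D j\<close> is also a family in the
  \<open>D j\<close>, so uniqueness of decompositions is inherited from the ambient direct sum. To
  see that a subgroup is graded, it then suffices to exhibit one decomposition of each element,
  which is what \<open>ex\<close> asks for.\<close>

lemma internal_direct_sum_restrict:
  assumes A: "abelian_group A"
    and sum: "internal_direct_sum A (carrier A) J D"
    and K: "additive_subgroup K A"
    and ex: "\<And>x. x \<in> K \<Longrightarrow> \<exists>f \<in> \<Pi>\<^sub>E j\<in>J. K \<inter> D j. finite {j \<in> J. f j \<noteq> \<zero>\<^bsub>A\<^esub>} \<and>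
      x = (\<Oplus>\<^bsub>A\<^esub>j\<in>{j \<in> J. f j \<noteq> \<zero>\<^bsub>A\<^esub>}. f j)"
  shows "internal_direct_sum A K J (\<lambda>j. K \<inter> D j)"
proof -
  interpret A: abelian_group A by (fact A)
  have KA: "K \<subseteq> carrier A"
    using K by (rule additive_subgroup.a_subset)
  have D: "additive_subgroup (D j) A" if "j \<in> J" for j
    using sum that by (simp add: internal_direct_sum_def)
  have sub: "additive_subgroup (K \<inter> D j) A" if "j \<in> J" for j
    using A.add.subgroups_Inter_pair[of K "D j"] K D[OF that]
    by (simp add: additive_subgroup_def)
  have uniq: "\<exists>\<^sub>\<le>\<^sub>1f. f \<in> (\<Pi>\<^sub>E j\<in>J. K \<inter> D j) \<and> finite {j \<in> J. f j \<noteq> \<zero>\<^bsub>A\<^esub>} \<and>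
      x = (\<Oplus>\<^bsub>A\<^esub>j\<in>{j \<in> J. f j \<noteq> \<zero>\<^bsub>A\<^esub>}. f j)"  if "x \<in> K" for x
  proof -
    have "\<exists>!f. f \<in> (\<Pi>\<^sub>E j\<in>J. D j) \<and> finite {j \<in> J. f j \<noteq> \<zero>\<^bsub>A\<^esub>} \<and>
        x = (\<Oplus>\<^bsub>A\<^esub>j\<in>{j \<in> J. f j \<noteq> \<zero>\<^bsub>A\<^esub>}. f j)" (is "Ex1 ?Q")
      using sum subsetD[OF KA that] unfolding internal_direct_sum_def by blast
    moreover have "?Q f" if "f \<in> (\<Pi>\<^sub>E j\<in>J. K \<inter> D j) \<and> finite {j \<in> J. f j \<noteq> \<zero>\<^bsub>A\<^esub>} \<and>
        x = (\<Oplus>\<^bsub>A\<^esub>j\<in>{j \<in> J. f j \<noteq> \<zero>\<^bsub>A\<^esub>}. f j)" for f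
      using that by (auto simp: PiE_iff)
    ultimately show ?thesis
      unfolding Uniq_def by blast
  qed
  show ?thesis
    unfolding internal_direct_sum_def
  proof (intro conjI ballI)
    fix x assume "x \<in> K"
    then show "\<exists>!f. f \<in> (\<Pi>\<^sub>E j\<in>J. K \<inter> D j) \<and> finite {j \<in> J. f j \<noteq> \<zero>\<^bsub>A\<^esub>} \<and>
        x = (\<Oplus>\<^bsub>A\<^esub>j\<in>{j \<in> J. f j \<noteq> \<zero>\<^bsub>A\<^esub>}. f j)"
      using uniq[of x] ex[of x] unfolding ex1_iff_ex_Uniq by blast
  qed (use K sub in auto)
qed

text \<open>Two finite sums of products are concatenated into one. This closure is what recombines
  the two products in \<open>Ie_prime_component_subset\<close>.\<close>

lemma (in module) set_smult_add:
  assumes A: "A \<subseteq> carrier R" and N: "N \<subseteq> carrier M"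
    and u: "u \<in> set_smult M A N" and v: "v \<in> set_smult M A N"
  shows "u \<oplus>\<^bsub>M\<^esub> v \<in> set_smult M A N"
proof -
  obtain k a n where u_eq: "u = (\<Oplus>\<^bsub>M\<^esub>i\<in>{..<k::nat}. a i \<odot>\<^bsub>M\<^esub> n i)"
    and a: "a \<in> {..<k} \<rightarrow> A" and n: "n \<in> {..<k} \<rightarrow> N"
    using u unfolding set_smult_def by blast
  obtain l b m where v_eq: "v = (\<Oplus>\<^bsub>M\<^esub>i\<in>{..<l::nat}. b i \<odot>\<^bsub>M\<^esub> m i)"
    and b: "b \<in> {..<l} \<rightarrow> A" and m: "m \<in> {..<l} \<rightarrow> N"
    using v unfolding set_smult_def by blast
  \<comment> \<open>Scalars and vectors of the concatenated sum: indices below \<open>k\<close>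
    serve \<open>u\<close>, and index \<open>k + i\<close> serves the \<open>i\<close>-th term of
    \<open>v\<close>.\<close>
  define c where "c i = (if i < k then a i else b (i - k))" for i
  define p where "p i = (if i < k then n i else m (i - k))" for i
  have c: "c \<in> {..<k + l} \<rightarrow> A" and p: "p \<in> {..<k + l} \<rightarrow> N"
    using a b n m by (auto simp: c_def p_def Pi_iff)
  have cp: "(\<lambda>i. c i \<odot>\<^bsub>M\<^esub> p i) \<in> {..<k + l} \<rightarrow> carrier M"
    using c p A N by (intro funcsetI smult_closed) (auto simp: Pi_iff)
  \<comment> \<open>Writing the upper block as a translate of \<open>{..<l}\<close> lets reindexing
    turn its sum into the one that defines \<open>v\<close>.\<close>
  have split: "{..<k + l} = {..<k} \<union> (\<lambda>i. i + k) ` {..<l}"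
    using ivl_disj_un_one(2)[of k "k + l"] image_add_atLeastLessThan'[of k 0 l]
    by (simp add: lessThan_atLeast0 add.commute)
  have "(\<Oplus>\<^bsub>M\<^esub>i\<in>{..<k + l}. c i \<odot>\<^bsub>M\<^esub> p i) =
      (\<Oplus>\<^bsub>M\<^esub>i\<in>{..<k}. c i \<odot>\<^bsub>M\<^esub> p i) \<oplus>\<^bsub>M\<^esub> (\<Oplus>\<^bsub>M\<^esub>i\<in>(\<lambda>i. i + k) ` {..<l}. c i \<odot>\<^bsub>M\<^esub> p i)"
    using cp unfolding split by (intro M.finsum_Un_disjoint) auto
  also have "(\<Oplus>\<^bsub>M\<^esub>i\<in>(\<lambda>i. i + k) ` {..<l}. c i \<odot>\<^bsub>M\<^esub> p i) =
      (\<Oplus>\<^bsub>M\<^esub>i\<in>{..<l}. c (i + k) \<odot>\<^bsub>M\<^esub> p (i + k))"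
    using cp unfolding split by (intro M.finsum_reindex) (auto simp: inj_on_def)
  also have "\<dots> = v"
    by (simp add: v_eq c_def p_def)
  also have "(\<Oplus>\<^bsub>M\<^esub>i\<in>{..<k}. c i \<odot>\<^bsub>M\<^esub> p i) = u"
    unfolding u_eq using a n A N
    by (intro M.finsum_cong') (auto simp: c_def p_def Pi_iff subset_iff intro!: smult_closed)
  finally show ?thesis
    using c p unfolding set_smult_def by (auto intro!: exI[of _ "k + l"] exI[of _ c] exI[of _ p])
qed

lemma (in module) submodule_cyclic:
  assumes x: "x \<in> carrier M"
  shows "submodule ((\<lambda>s. s \<odot>\<^bsub>M\<^esub> x) ` carrier R) R M"
proof (rule submoduleI)
  show "\<zero>\<^bsub>M\<^esub> \<in> (\<lambda>s. s \<odot>\<^bsub>M\<^esub> x) ` carrier R"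
    using x by (intro image_eqI[of _ _ "\<zero>"]) auto
next
  fix a assume "a \<in> (\<lambda>s. s \<odot>\<^bsub>M\<^esub> x) ` carrier R"
  then show "\<ominus>\<^bsub>M\<^esub> a \<in> (\<lambda>s. s \<odot>\<^bsub>M\<^esub> x) ` carrier R"
    using x by (force simp: smult_l_minus[symmetric])
next
  fix a b assume "a \<in> (\<lambda>s. s \<odot>\<^bsub>M\<^esub> x) ` carrier R" "b \<in> (\<lambda>s. s \<odot>\<^bsub>M\<^esub> x) ` carrier R"
  then show "a \<oplus>\<^bsub>M\<^esub> b \<in> (\<lambda>s. s \<odot>\<^bsub>M\<^esub> x) ` carrier R"
    using x by (force simp: smult_l_distr[symmetric])
next
  fix a y assume "a \<in> carrier R" "y \<in> (\<lambda>s. s \<odot>\<^bsub>M\<^esub> x) ` carrier R"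
  then show "a \<odot>\<^bsub>M\<^esub> y \<in> (\<lambda>s. s \<odot>\<^bsub>M\<^esub> x) ` carrier R"
    using x by (force simp: smult_assoc1[symmetric])
qed (use x in auto)

lemma (in module) finsum_smult_rdistr:
  assumes "finite A" "f \<in> A \<rightarrow> carrier R" "x \<in> carrier M"
  shows "(\<Oplus>i\<in>A. f i) \<odot>\<^bsub>M\<^esub> x = (\<Oplus>\<^bsub>M\<^esub>i\<in>A. f i \<odot>\<^bsub>M\<^esub> x)"
  using assms by (induction rule: finite_induct) (auto simp: Pi_def smult_l_distr)

context graded_module
begin

lemma ring_component_subset: "g \<in> carrier G \<Longrightarrow> Rg g \<subseteq> carrier R"
  using ring_direct_sum by (simp add: internal_direct_sum_def)

lemma module_component_subgroup: "g \<in> carrier G \<Longrightarrow> additive_subgroup (Mg g) M"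
  using module_direct_sum by (simp add: internal_direct_sum_def)

lemma module_component_subset: "g \<in> carrier G \<Longrightarrow> Mg g \<subseteq> carrier M"
  using module_direct_sum by (simp add: internal_direct_sum_def)

text \<open>If \<open>s\<close> has homogeneous parts \<open>c g\<close>, then \<open>s x\<close> is
  the sum of the elements \<open>c g x\<close>. Each of these is a multiple of \<open>x\<close> and
  has degree \<open>g h\<close>; right translation by \<open>h\<close> is injective, so distinct
  parts land in distinct degrees.\<close>

lemma graded_submodule_cyclic:
  assumes h: "h \<in> carrier G" and x: "x \<in> Mg h"
  shows "graded_submodule G R M Mg ((\<lambda>s. s \<odot>\<^bsub>M\<^esub> x) ` carrier R)" (is "graded_submodule _ _ _ _ ?K")
proof -
  note G_assoc = monoid.m_assoc[OF group.is_monoid[OF group_axioms]]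
  have xM: "x \<in> carrier M"
    using module_component_subset[OF h] x by blast
  note K = submodule_cyclic[OF xM]
  have "internal_direct_sum M ?K (carrier G) (\<lambda>g. ?K \<inter> Mg g)"
  proof (rule internal_direct_sum_restrict[OF M.abelian_group_axioms module_direct_sum])
    show "additive_subgroup ?K M"
      using submodule.axioms(1)[OF K] by (rule additive_subgroup.intro)
  next
    fix y assume "y \<in> ?K"
    then obtain s where s: "s \<in> carrier R" and y: "y = s \<odot>\<^bsub>M\<^esub> x" by blast
    obtain c where c: "c \<in> (\<Pi>\<^sub>E g\<in>carrier G. Rg g)"
      and fin: "finite {g \<in> carrier G. c g \<noteq> \<zero>\<^bsub>R\<^esub>}"
      and s_eq: "s = (\<Oplus>\<^bsub>R\<^esub>g\<in>{g \<in> carrier G. c g \<noteq> \<zero>\<^bsub>R\<^esub>}. c g)"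
      using ring_direct_sum s unfolding internal_direct_sum_def by blast
    let ?S = "{g \<in> carrier G. c g \<noteq> \<zero>\<^bsub>R\<^esub>}"
    have cg: "c g \<in> Rg g" "c g \<in> carrier R" if "g \<in> carrier G" for g
      using c that ring_component_subset[OF that] by auto
    \<comment> \<open>Solving \<open>g h = j\<close> for \<open>g\<close> gives the part of
      \<open>s\<close> that contributes to degree \<open>j\<close>. The inverse stands on the right
      because \<open>G\<close> may be noncommutative, and the restriction to
      \<open>carrier G\<close> makes \<open>f\<close> extensional.\<close>
    define f where "f = (\<lambda>j\<in>carrier G. c (j \<otimes>\<^bsub>G\<^esub> inv\<^bsub>G\<^esub> h) \<odot>\<^bsub>M\<^esub> x)"
    have f_shift: "f (g \<otimes>\<^bsub>G\<^esub> h) = c g \<odot>\<^bsub>M\<^esub> x" if "g \<in> carrier G" for g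
      using that h by (simp add: f_def G_assoc)
    have f_in: "f j \<in> ?K \<inter> Mg j" if j: "j \<in> carrier G" for j
    proof -
      have g: "j \<otimes>\<^bsub>G\<^esub> inv\<^bsub>G\<^esub> h \<in> carrier G" using j h by simp
      have "c (j \<otimes>\<^bsub>G\<^esub> inv\<^bsub>G\<^esub> h) \<odot>\<^bsub>M\<^esub> x \<in> Mg (j \<otimes>\<^bsub>G\<^esub> inv\<^bsub>G\<^esub> h \<otimes>\<^bsub>G\<^esub> h)"
        using module_graded_smult[OF g h cg(1)[OF g] x] .
      then show ?thesis
        using j h cg(2)[OF g] by (simp add: f_def G_assoc)
    qed
    have f_carrier: "f j \<in> carrier M" if "j \<in> carrier G" for j
      using f_in[OF that] xM by auto
    \<comment> \<open>The inclusion can be strict, since a nonzero \<open>c g\<close> may annihilate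
      \<open>x\<close>. The surplus indices carry zero terms and are dropped in the last step of the
      chain of sums below.\<close>
    have supp: "{j \<in> carrier G. f j \<noteq> \<zero>\<^bsub>M\<^esub>} \<subseteq> (\<lambda>g. g \<otimes>\<^bsub>G\<^esub> h) ` ?S" (is "?T \<subseteq> _")
    proof
      fix j assume j: "j \<in> ?T"
      then have "c (j \<otimes>\<^bsub>G\<^esub> inv\<^bsub>G\<^esub> h) \<noteq> \<zero>\<^bsub>R\<^esub>"
        using xM by (auto simp: f_def)
      then show "j \<in> (\<lambda>g. g \<otimes>\<^bsub>G\<^esub> h) ` ?S"
        using j h by (intro image_eqI[of _ _ "j \<otimes>\<^bsub>G\<^esub> inv\<^bsub>G\<^esub> h"]) (auto simp: G_assoc)
    qed
    have "y = (\<Oplus>\<^bsub>M\<^esub>g\<in>?S. c g \<odot>\<^bsub>M\<^esub> x)"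
      unfolding y s_eq using fin cg xM by (intro finsum_smult_rdistr) auto
    also have "\<dots> = (\<Oplus>\<^bsub>M\<^esub>g\<in>?S. f (g \<otimes>\<^bsub>G\<^esub> h))"
      using cg xM h by (intro M.finsum_cong') (auto simp: f_shift)
    also have "\<dots> = (\<Oplus>\<^bsub>M\<^esub>j\<in>(\<lambda>g. g \<otimes>\<^bsub>G\<^esub> h) ` ?S. f j)"
      using h f_carrier by (intro M.finsum_reindex[symmetric]) (auto simp: inj_on_def)
    also have "\<dots> = (\<Oplus>\<^bsub>M\<^esub>j\<in>?T. f j)"
      using supp fin h f_carrier by (intro M.add.finprod_mono_neutral_cong_right) auto
    finally have "y = (\<Oplus>\<^bsub>M\<^esub>j\<in>?T. f j)" .
    moreover have "f \<in> (\<Pi>\<^sub>E j\<in>carrier G. ?K \<inter> Mg j)"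
      using f_in by (auto simp: PiE_iff extensional_def f_def)
    moreover have "finite ?T"
      using finite_subset[OF supp] fin by blast
    ultimately show "\<exists>f \<in> \<Pi>\<^sub>E j\<in>carrier G. ?K \<inter> Mg j. finite {j \<in> carrier G. f j \<noteq> \<zero>\<^bsub>M\<^esub>} \<and>
        y = (\<Oplus>\<^bsub>M\<^esub>j\<in>{j \<in> carrier G. f j \<noteq> \<zero>\<^bsub>M\<^esub>}. f j)"
      by blast
  qed
  with K show ?thesis by (simp add: graded_submodule_def)
qed

text \<open>This is the forward implication for fixed \<open>K\<close>, \<open>r\<close> and
  \<open>h\<close>, with the alternative that \<open>r\<close> lies in the colon ideal ruled out in
  advance.\<close>

lemma Ie_prime_component_subset:
  assumes I: "graded_ideal G R Rg I" and prime: "graded_Ie_prime G R Rg M Mg I N"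
    and K: "graded_submodule G R M Mg K" and r: "r \<in> homogeneous G Rg" and h: "h \<in> carrier G"
    and sub: "(\<lambda>x. r \<odot>\<^bsub>M\<^esub> x) ` (K \<inter> Mg h) \<subseteq> N"
    and nsub: "\<not> (\<lambda>x. r \<odot>\<^bsub>M\<^esub> x) ` (K \<inter> Mg h) \<subseteq> set_smult M (I \<inter> Rg \<one>\<^bsub>G\<^esub>) N"
    and r_colon: "r \<notin> module_colon R M N"
  shows "K \<inter> Mg h \<subseteq> N"
proof (rule subsetI, rule ccontr)
  let ?S = "set_smult M (I \<inter> Rg \<one>\<^bsub>G\<^esub>) N"
  fix y assume y: "y \<in> K \<inter> Mg h" and yN: "y \<notin> N"
  have N: "subgroup N (add_monoid M)"
    using prime by (auto simp: graded_Ie_prime_def graded_submodule_def dest: submodule.axioms(1))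
  have Kh: "subgroup (K \<inter> Mg h) (add_monoid M)"
    using K module_component_subgroup[OF h] submodule.axioms(1)[of K R M]
    by (auto simp: graded_submodule_def additive_subgroup_def intro: M.add.subgroups_Inter_pair)
  have rR: "r \<in> carrier R"
    using r ring_component_subset by (auto simp: homogeneous_def)
  have IR: "I \<inter> Rg \<one>\<^bsub>G\<^esub> \<subseteq> carrier R"
    using I by (auto simp: graded_ideal_def dest: ideal.Icarr)
  \<comment> \<open>Primeness read backwards: \<open>r z\<close> lies in \<open>N\<close> by
    \<open>sub\<close>, and both permitted conclusions fail, so the premise that \<open>r z\<close>
    avoids \<open>?S\<close> must fail.\<close>
  have in_S: "r \<odot>\<^bsub>M\<^esub> z \<in> ?S" if "z \<in> K \<inter> Mg h" "z \<notin> N" for z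
    using prime r h that sub r_colon unfolding graded_Ie_prime_def homogeneous_def by blast
  obtain x where x: "x \<in> K \<inter> Mg h" and rx: "r \<odot>\<^bsub>M\<^esub> x \<notin> ?S"
    using nsub by blast
  have xN: "x \<in> N" using in_S x rx by blast
  have xM: "x \<in> carrier M" and yM: "y \<in> carrier M"
    using subgroup.subset[OF Kh] x y by auto
  have xy_K: "x \<oplus>\<^bsub>M\<^esub> y \<in> K \<inter> Mg h" and my_K: "\<ominus>\<^bsub>M\<^esub> y \<in> K \<inter> Mg h"
    using subgroup.m_closed[OF Kh x y] subgroup.m_inv_closed[OF Kh y] by (auto simp: a_inv_def)
  have minus_N: "\<ominus>\<^bsub>M\<^esub> z \<in> N" if "z \<in> N" for z
    using subgroup.m_inv_closed[OF N that] by (simp add: a_inv_def)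
  have "\<ominus>\<^bsub>M\<^esub> y \<notin> N"
    using minus_N[of "\<ominus>\<^bsub>M\<^esub> y"] yM yN by auto
  moreover have "x \<oplus>\<^bsub>M\<^esub> y \<notin> N"
  proof
    assume "x \<oplus>\<^bsub>M\<^esub> y \<in> N"
    then have "\<ominus>\<^bsub>M\<^esub> x \<oplus>\<^bsub>M\<^esub> (x \<oplus>\<^bsub>M\<^esub> y) \<in> N"
      using subgroup.m_closed[OF N minus_N[OF xN]] by simp
    then show False
      using xM yM yN by (simp add: M.r_neg1)
  qed
  \<comment> \<open>Applying \<open>in_S\<close> to \<open>- y\<close> itself keeps the combination
    a sum, as \<open>set_smult_add\<close> requires.\<close>
  ultimately have "r \<odot>\<^bsub>M\<^esub> (x \<oplus>\<^bsub>M\<^esub> y) \<oplus>\<^bsub>M\<^esub> r \<odot>\<^bsub>M\<^esub> (\<ominus>\<^bsub>M\<^esub> y) \<in> ?S"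
    using set_smult_add[OF IR] subgroup.subset[OF N] in_S xy_K my_K by simp
  moreover have "r \<odot>\<^bsub>M\<^esub> (x \<oplus>\<^bsub>M\<^esub> y) \<oplus>\<^bsub>M\<^esub> r \<odot>\<^bsub>M\<^esub> (\<ominus>\<^bsub>M\<^esub> y) = r \<odot>\<^bsub>M\<^esub> x"
    using rR xM yM by (simp add: smult_r_distr[symmetric] M.a_assoc M.r_neg)
  ultimately show False using rx by simp
qed

text \<open>The unit scalar puts \<open>x\<close> into its own cyclic submodule. This carries
  statements between the element \<open>x\<close> and the component of degree
  \<open>h\<close>.\<close>

lemma homogeneous_in_cyclic_component:
  assumes "h \<in> carrier G" "x \<in> Mg h"
  shows "x \<in> (\<lambda>s. s \<odot>\<^bsub>M\<^esub> x) ` carrier R \<inter> Mg h"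
proof -
  have "x \<in> carrier M"
    using module_component_subset[OF assms(1)] assms(2) by blast
  then show ?thesis
    using assms(2) by (intro IntI image_eqI[of _ _ "\<one>\<^bsub>R\<^esub>"]) auto
qed

end

theorem theorem2p15:
  fixes G :: "('g, 'p) monoid_scheme"
    and R :: "('a, 'q) ring_scheme"
    and Rg :: "'g \<Rightarrow> 'a set"
    and M :: "('a, 'b, 'r) module_scheme"
    and Mg :: "'g \<Rightarrow> 'b set"
    and I :: "'a set"
    and N :: "'b set"
  assumes "graded_module G R Rg M Mg"
    and "graded_ideal G R Rg I"
    and "graded_submodule G R M Mg N"
    and "N \<noteq> carrier M"
  shows "graded_Ie_prime G R Rg M Mg I N \<longleftrightarrow>
    (\<forall>K. graded_submodule G R M Mg K \<longrightarrow>
      (\<forall>r\<in>homogeneous G Rg. \<forall>h\<in>carrier G.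
        (\<lambda>x. r \<odot>\<^bsub>M\<^esub> x) ` (K \<inter> Mg h) \<subseteq> N \<and>
        \<not> (\<lambda>x. r \<odot>\<^bsub>M\<^esub> x) ` (K \<inter> Mg h) \<subseteq> set_smult M (I \<inter> Rg \<one>\<^bsub>G\<^esub>) N \<longrightarrow>
        K \<inter> Mg h \<subseteq> N \<or> r \<in> module_colon R M N))"
proof -
  interpret graded_module G R Rg M Mg by (fact assms(1))
  show ?thesis (is "?prime \<longleftrightarrow> ?comp")
  proof
    assume ?prime
    then show ?comp
      using Ie_prime_component_subset[OF assms(2)] by blast
  next
    assume comp: ?comp
    have "x \<in> N"
      if r: "r \<in> homogeneous G Rg" and x: "x \<in> homogeneous G Mg" and rx: "r \<odot>\<^bsub>M\<^esub> x \<in> N"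
        and nrx: "r \<odot>\<^bsub>M\<^esub> x \<notin> set_smult M (I \<inter> Rg \<one>\<^bsub>G\<^esub>) N"
        and r_colon: "r \<notin> module_colon R M N" for r x
    proof -
      obtain h where h: "h \<in> carrier G" and xh: "x \<in> Mg h"
        using x by (auto simp: homogeneous_def)
      let ?K = "(\<lambda>s. s \<odot>\<^bsub>M\<^esub> x) ` carrier R"
      have xM: "x \<in> carrier M"
        using module_component_subset[OF h] xh by blast
      have rR: "r \<in> carrier R"
        using r ring_component_subset by (auto simp: homogeneous_def)
      have xK: "x \<in> ?K \<inter> Mg h"
        using homogeneous_in_cyclic_component[OF h xh] .
      have N: "submodule N R M"
        using assms(3) by (simp add: graded_submodule_def)
      \<comment> \<open>The component of \<open>?K\<close> in degree \<open>h\<close> may contain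
        further multiples of \<open>x\<close>, so the inclusion in \<open>N\<close> is checked for
        all of them: commutativity of \<open>R\<close> moves \<open>r\<close> next to
        \<open>x\<close>, and \<open>N\<close> absorbs \<open>s\<close>.\<close>
      have "r \<odot>\<^bsub>M\<^esub> (s \<odot>\<^bsub>M\<^esub> x) \<in> N" if s: "s \<in> carrier R" for s
      proof -
        have "r \<odot>\<^bsub>M\<^esub> (s \<odot>\<^bsub>M\<^esub> x) = s \<odot>\<^bsub>M\<^esub> (r \<odot>\<^bsub>M\<^esub> x)"
          using rR s xM by (simp add: smult_assoc1[symmetric] m_comm)
        then show ?thesis
          using submodule.smult_closed[OF N s rx] by simp
      qed
      then have "(\<lambda>z. r \<odot>\<^bsub>M\<^esub> z) ` (?K \<inter> Mg h) \<subseteq> N" by auto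
      \<comment> \<open>The element \<open>x\<close> itself is the witness.\<close>
      moreover have "\<not> (\<lambda>z. r \<odot>\<^bsub>M\<^esub> z) ` (?K \<inter> Mg h) \<subseteq> set_smult M (I \<inter> Rg \<one>\<^bsub>G\<^esub>) N"
        using xK nrx by blast
      ultimately have "?K \<inter> Mg h \<subseteq> N"
        using comp graded_submodule_cyclic[OF h xh] r h r_colon by blast
      with xK show ?thesis by blast
    qed
    then show ?prime
      using assms(3,4) unfolding graded_Ie_prime_def by blast
  qed
qed

end
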